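(* For a sequence $\boldsymbol\vartheta=(\vartheta_0,\vartheta_1,\dots)$ of complex numbers put $\mathscr D_0(\boldsymbol\vartheta)=1$ and, for $n\ge1$, $$\mathscr D_n(\boldsymbol\vartheta)=(-1)^{n(n-1)/2}\,\frac{\prod_{0\le r<s<n}(\vartheta_s-\vartheta_r)}{\prod_{r=0}^{n-1}\Gamma(\vartheta_r+n+1)} .$$ Then for every $n\in\mathbb N_0$, $$\det\left[\frac1{\Gamma(\vartheta_r+s+2)}\right]_{r,s=0}^{n-1}=\mathscr D_n(\boldsymbol\vartheta).$$
   Context: $1/\Gamma$ is understood as an entire function (zero at the poles of $\Gamma$); the empty determinant ($n=0$) equals $1$. *)

theory Defs
  imports "HOL-Analysis.Gamma_Function" "Jordan_Normal_Form.Determinant"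
begin

text \<open>
  The reciprocal \<open>1 / \<Gamma>\<close> is the entire function \<^const>\<open>rGamma\<close>, which vanishes at the
  poles of \<open>\<Gamma>\<close>; hence the product of Gamma values in the denominator is written as a product
  of \<^const>\<open>rGamma\<close> values in the numerator.  The pairs \<open>0 \<le> r < s < n\<close> are enumerated
  by \<open>s\<close> first.
\<close>

definition scrD :: "nat \<Rightarrow> (nat \<Rightarrow> complex) \<Rightarrow> complex" where
  "scrD n \<theta> =
     (if n = 0 then 1
      else (- 1) ^ (n * (n - 1) div 2) * (\<Prod>s<n. \<Prod>r<s. \<theta> s - \<theta> r)
             * (\<Prod>r<n. rGamma (\<theta> r + of_nat n + 1)))"

end

theory Submission
  imports Defs
begin

text \<open>
  The recurrence \<open>1 / \<Gamma>(z) = z / \<Gamma>(z + 1)\<close> pulls the factor \<open>1 / \<Gamma>(\<theta>\<^sub>r + n + 1)\<close> out of row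
  \<open>r\<close>; column \<open>s\<close> then consists of values at the \<open>\<theta>\<^sub>r\<close> of the monic polynomial
  \<open>(x + s + 2) \<cdots> (x + n)\<close> of degree \<open>n - 1 - s\<close>. What remains is thus a Vandermonde determinant
  with its columns reversed, which accounts for the sign.
\<close>

lemma det_scale_rows:
  fixes f :: "nat \<Rightarrow> nat \<Rightarrow> 'a::comm_ring_1"
  shows "Determinant.det (Matrix.mat n n (\<lambda>(r, s). c r * f r s))
       = (\<Prod>r<n. c r) * Determinant.det (Matrix.mat n n (\<lambda>(r, s). f r s))"
proof -
  have "(\<Prod>i = 0..<n. Matrix.mat n n (\<lambda>(r, s). c r * f r s) $$ (i, p i))
      = (\<Prod>r<n. c r) * (\<Prod>i = 0..<n. Matrix.mat n n (\<lambda>(r, s). f r s) $$ (i, p i))"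
    if "p permutes {0..<n}" for p
  proof -
    \<comment> \<open>The entry at \<open>(i, p i)\<close> can be evaluated only once
      \<open>p i\<close> is known to be in range.\<close>
    have "p i < n" if "i < n" for i
      using permutes_in_image[OF \<open>p permutes {0..<n}\<close>, of i] that by simp
    then show ?thesis
      by (simp add: prod.distrib atLeast0LessThan cong: prod.cong_simp)
  qed
  then show ?thesis
    unfolding det_def'[OF mat_carrier] sum_distrib_left
    by (intro sum.cong) (simp_all add: mult.left_commute del: index_mat)
qed

text \<open>Splits off the factors with \<open>r = 0\<close>, matching the row factors and the
  shifted minor in the induction below.\<close>

lemma vandermonde_prod_Suc:
  fixes x :: "nat \<Rightarrow> 'a::comm_ring_1"
  shows "(\<Prod>s<Suc m. \<Prod>r<s. x s - x r)
       = (\<Prod>s<m. x (Suc s) - x 0) * (\<Prod>s<m. \<Prod>r<s. x (Suc s) - x (Suc r))"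
  unfolding prod.lessThan_Suc_shift by (simp add: prod.distrib del: prod.lessThan_Suc)

lemma minus_one_power_triangular_Suc:
  "(- 1 :: 'a::comm_ring_1) ^ (Suc m * m div 2) = (- 1) ^ m * (- 1) ^ (m * (m - 1) div 2)"
proof -
  have "Suc m * m = 2 * m + m * (m - 1)" by (cases m) auto
  then have "Suc m * m div 2 = m + m * (m - 1) div 2"
    by (metis div_mult_self4 zero_neq_numeral)
  then show ?thesis by (simp add: power_add)
qed

text \<open>The value does not depend on \<open>a\<close>: lower-order terms of the monic column
  polynomials can be removed by column operations. \<open>x\<close> and \<open>a\<close> both vary
  in the induction, since the minor that remains involves both sequences shifted by one.\<close>

lemma det_reversed_vandermonde:
  fixes x :: "nat \<Rightarrow> 'a::comm_ring_1"
  shows "Determinant.det (Matrix.mat n n (\<lambda>(r, s). \<Prod>j = Suc s..<n. x r + a j))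
       = (- 1) ^ (n * (n - 1) div 2) * (\<Prod>s<n. \<Prod>r<s. x s - x r)"
proof (induction n arbitrary: x a)
  case 0
  then show ?case by (simp add: det_dim_zero)
next
  case (Suc m)
  let ?p = "\<lambda>s z. \<Prod>j = Suc s..<Suc m. z + a j"
  define A where "A = Matrix.mat (Suc m) (Suc m) (\<lambda>(r, s). ?p s (x r))"
  \<comment> \<open>Subtracts \<open>x\<^sub>0 + a\<^sub>s\<^sub>+\<^sub>1\<close> times column \<open>s + 1\<close> from column \<open>s\<close>, which clears row \<open>0\<close> except for
    its last entry.\<close>
  define T where "T = Matrix.mat (Suc m) (Suc m)
    (\<lambda>(i, s). if i = s then 1 else if i = Suc s then - (x 0 + a (Suc s)) else 0)"
  define B where "B = Matrix.mat (Suc m) (Suc m)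
    (\<lambda>(r, s). if s < m then (x r - x 0) * ?p (Suc s) (x r) else 1)"
  have AT: "A * T = B"
  proof (rule eq_matI)
    fix r s assume "r < dim_row B" "s < dim_col B"
    then have r: "r < Suc m" and s: "s < Suc m" by (auto simp: B_def)
    have "(A * T) $$ (r, s) = (\<Sum>i<Suc m. ?p i (x r) *
        (if i = s then 1 else if i = Suc s then - (x 0 + a (Suc s)) else 0))"
      using r s by (simp add: A_def T_def scalar_prod_def atLeast0LessThan
          del: sum.lessThan_Suc cong: sum.cong_simp)
    also have "\<dots> = (\<Sum>i<Suc m. (if i = s then ?p i (x r) else 0)
        + (if i = Suc s then - (x 0 + a (Suc s)) * ?p i (x r) else 0))"
      by (intro sum.cong) auto
    \<comment> \<open>For \<open>s = m\<close> no index \<open>i = Suc s\<close> is in range: the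
      last column stays the constant 1, an empty product.\<close>
    also have "\<dots> = ?p s (x r) + (if s < m then - (x 0 + a (Suc s)) * ?p (Suc s) (x r) else 0)"
      using s by (simp add: sum.distrib del: sum.lessThan_Suc)
    also have "\<dots> = B $$ (r, s)"
    proof (cases "s < m")
      case True
      then have "?p s (x r) = (x r + a (Suc s)) * ?p (Suc s) (x r)"
        by (intro prod.atLeast_Suc_lessThan) simp
      with True r show ?thesis by (simp add: B_def algebra_simps)
    next
      case False
      with r s show ?thesis by (simp add: B_def)
    qed
    finally show "(A * T) $$ (r, s) = B $$ (r, s)" .
  qed (auto simp: A_def B_def T_def)
  have "Determinant.det T = 1"
  proof -
    have "Determinant.det T = prod_list (diag_mat T)"
      by (rule det_lower_triangular[of "Suc m"]) (auto simp: T_def)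
    also have "diag_mat T = map (\<lambda>i. 1) [0..<Suc m]"
      unfolding diag_mat_def by (rule map_cong) (auto simp: T_def)
    finally show ?thesis by (simp add: map_replicate_const del: upt_Suc)
  qed
  then have "Determinant.det A = Determinant.det B"
    using det_mult[of A "Suc m" T] unfolding AT by (simp add: A_def T_def)
  also have "\<dots> = (\<Sum>s<Suc m. B $$ (0, s) * cofactor B 0 s)"
    by (rule laplace_expansion_row[of _ "Suc m"]) (auto simp: B_def)
  \<comment> \<open>In row 0 the factor \<open>x r - x 0\<close> vanishes, so only the last entry,
    which is 1, contributes.\<close>
  also have "\<dots> = cofactor B 0 m"
    by (simp add: B_def)
  also have "\<dots> = (- 1) ^ m * Determinant.det (mat_delete B 0 m)"
    by (simp add: cofactor_def)
  also have "mat_delete B 0 m = Matrix.mat m m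
      (\<lambda>(r, s). (x (Suc r) - x 0) * (\<Prod>j = Suc s..<m. x (Suc r) + a (Suc j)))"
    by (rule eq_matI) (auto simp: mat_delete_def B_def prod.shift_bounds_Suc_ivl
        simp del: prod.op_ivl_Suc)
  also have "Determinant.det \<dots> = (\<Prod>r<m. x (Suc r) - x 0) *
      ((- 1) ^ (m * (m - 1) div 2) * (\<Prod>s<m. \<Prod>r<s. x (Suc s) - x (Suc r)))"
    by (simp only: det_scale_rows Suc.IH[of "\<lambda>r. x (Suc r)" "\<lambda>j. a (Suc j)"])
  finally show ?case
    unfolding A_def vandermonde_prod_Suc diff_Suc_1 minus_one_power_triangular_Suc
    by (simp add: mult_ac)
qed

text \<open>Iterates \<open>z * rGamma (z + 1) = rGamma z\<close>, which holds for every
  \<open>z\<close>, including the poles of Gamma.\<close>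

lemma rGamma_eq_prod_mult_rGamma:
  fixes z :: "'a::Gamma"
  assumes "k \<le> n"
  shows "rGamma (z + of_nat k) = rGamma (z + of_nat n) * (\<Prod>j = k..<n. z + of_nat j)"
  using assms
proof (induction n rule: dec_induct)
  case (step n)
  then show ?case
    using rGamma_plus1[of "z + of_nat n"] by (simp add: mult_ac add_ac)
qed simp

theorem proposition8p2:
  fixes \<theta> :: "nat \<Rightarrow> complex" and n :: nat
  shows "Determinant.det (Matrix.mat n n (\<lambda>(r, s). rGamma (\<theta> r + of_nat s + 2))) = scrD n \<theta>"
proof -
  have "rGamma (\<theta> r + of_nat s + 2)
      = rGamma (\<theta> r + of_nat n + 1) * (\<Prod>j = Suc s..<n. \<theta> r + (of_nat j + 1))"
    if "s < n" for r s
    \<comment> \<open>The base point \<open>\<theta> r + 1\<close> turns the offsets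
      \<open>s + 2\<close> and \<open>n + 1\<close> into \<open>Suc s\<close> and \<open>n\<close>;
      hence \<open>a j = j + 1\<close> in the determinant.\<close>
    using rGamma_eq_prod_mult_rGamma[of "Suc s" n "\<theta> r + 1"] that
    by (simp add: add_ac)
  then have "Matrix.mat n n (\<lambda>(r, s). rGamma (\<theta> r + of_nat s + 2))
      = Matrix.mat n n (\<lambda>(r, s). rGamma (\<theta> r + of_nat n + 1) *
          (\<Prod>j = Suc s..<n. \<theta> r + (of_nat j + 1)))"
    by (intro eq_matI) auto
  then show ?thesis
    by (simp add: det_scale_rows det_reversed_vandermonde scrD_def mult_ac)
qed

end
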